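(* Let $n\ge 3$ be an integer. The least volume ellipsoid $\mathcal{E}_n$ that contains the metric polytope $\mathcal{M}_n\subset\mathbb{R}^{\binom{[n]}{2}}$ is the $\binom{n}{2}$-dimensional (Euclidean) ball of radius $\frac12\sqrt{\binom n2}$ centered at the point all of whose coordinates equal $\frac12$. Moreover, shrinking $\mathcal{E}_n$ about its center by a factor of $\sqrt{3\binom n2}$ (that is, multiplying its radius by $1/\sqrt{3\binom n2}$) yields a ball that is contained in $\mathcal{M}_n$, and this factor is tight: for no $0<s<\sqrt{3\binom n2}$ is the ball obtained from $\mathcal{E}_n$ by shrinking it about its center by a factor of $s$ contained in $\mathcal{M}_n$.
   Context: For an integer $n\ge 3$, $\mathbb{R}^{\binom{[n]}{2}}$ denotes the real $\binom n2$-dimensional space (with the standard Euclidean structure) whose coordinates are indexed by unordered pairs $ij$, $1\le i\ne j\le n$; write $d_{ij}=d_{ji}$. The metric polytope $\mathcal{M}_n$ is the set of all $d\in[0,1]^{\binom{[n]}{2}}$ such that $d_{ij}+d_{jk}-d_{ik}\ge 0$ for all distinct $i,j,k\in\{1,\dots,n\}$ (equivalently, all $n$-point (semi)metric spaces of diameter at most $1$). An ellipsoid in $\mathbb{R}^m$ is a set of the form $A\mathbf{B}_m+c$ where $\mathbf{B}_m$ is the closed Euclidean unit ball, $A$ is a positive semidefinite $m\times m$ matrix and $c\in\mathbb{R}^m$ is its center. For every convex body the least volume ellipsoid containing it exists and is unique. *)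

theory Defs
  imports "HOL-Analysis.Analysis" "HOL-Library.Numeral_Type"
begin

text \<open>
  The points \<open>1, \<dots>, n\<close> are the elements of a finite type \<open>'n\<close> with \<open>n = CARD('n)\<close>.
  The coordinates of the ambient Euclidean space are indexed by the type of two-element subsets
  of \<open>'n\<close>; the sort \<open>card2\<close> (at least two elements) is what makes this type inhabited.
\<close>

typedef (overloaded) ('n::card2) upair = "{e :: 'n set. card e = 2}"
proof -
  have "2 \<le> card (UNIV :: 'n set)" by (rule two_le_card)
  then obtain e :: "'n set" where "card e = 2" by (metis obtain_subset_with_card_n)
  then show ?thesis by blast
qed

instance upair :: (card2) finite
proof
  have "(UNIV :: 'a upair set) = Abs_upair ` {e. card e = 2}"
    by (metis type_definition.Abs_image type_definition_upair)
  then show "finite (UNIV :: 'a upair set)"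
    by (metis finite finite_imageI)
qed

lemma CARD_upair: "CARD('n::card2 upair) = CARD('n) choose 2"
proof -
  have "CARD('n upair) = card {e :: 'n set. card e = 2}"
    by (rule type_definition.card[OF type_definition_upair])
  also have "\<dots> = CARD('n) choose 2"
    using n_subsets[of "UNIV :: 'n set" 2] by simp
  finally show ?thesis .
qed

text \<open>\<open>upair i j\<close> is the index \<open>ij = ji\<close>; it is only meaningful for \<open>i \<noteq> j\<close>.\<close>

definition upair :: "'n::card2 \<Rightarrow> 'n \<Rightarrow> 'n upair" where
  "upair i j = Abs_upair {i, j}"

lemma Rep_upair_upair: "i \<noteq> j \<Longrightarrow> Rep_upair (upair i j) = {i, j}"
  by (simp add: upair_def Abs_upair_inverse)

lemma upair_commute: "upair i j = upair j i"
  by (simp add: upair_def insert_commute)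

definition metric_polytope :: "(real ^ 'n::card2 upair) set" where
  "metric_polytope =
     {d. (\<forall>e. d $ e \<in> {0..1}) \<and>
         (\<forall>i j k. distinct [i, j, k] \<longrightarrow>
            d $ upair i j + d $ upair j k - d $ upair i k \<ge> 0)}"

definition positive_semidefinite :: "real ^ 'm ^ 'm \<Rightarrow> bool" where
  "positive_semidefinite A \<longleftrightarrow> transpose A = A \<and> (\<forall>x. x \<bullet> (A *v x) \<ge> 0)"

definition ellipsoid :: "(real ^ 'm) set \<Rightarrow> bool" where
  "ellipsoid E \<longleftrightarrow>
     (\<exists>A c. positive_semidefinite A \<and> E = (\<lambda>x. A *v x + c) ` cball 0 1)"

definition least_volume_ellipsoid :: "(real ^ 'm) set \<Rightarrow> (real ^ 'm) set \<Rightarrow> bool" where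
  "least_volume_ellipsoid K E \<longleftrightarrow>
     ellipsoid E \<and> K \<subseteq> E \<and>
     (\<forall>F. ellipsoid F \<and> K \<subseteq> F \<longrightarrow> measure lebesgue E \<le> measure lebesgue F)"

text \<open>Shrinking by a factor of \<open>s\<close> divides, rather than multiplies, all lengths by \<open>s\<close>.\<close>

definition shrink :: "'a::real_vector \<Rightarrow> real \<Rightarrow> 'a set \<Rightarrow> 'a set" where
  "shrink c s E = (\<lambda>x. c + (1 / s) *\<^sub>R (x - c)) ` E"

end

theory Submission
  imports Defs
begin

text \<open>
  Centred at \<open>1/2\<close>, the cut semimetrics are the vectors \<open>u / 2\<close> with \<open>u\<^sub>i\<^sub>j = - \<epsilon>\<^sub>i \<epsilon>\<^sub>j\<close>, \<open>\<epsilon> \<in> {1, -1}\<^sup>n\<close>; averaged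
  over all \<open>\<epsilon>\<close> they satisfy \<open>E u = 0\<close> and \<open>E u u\<^sup>T = I\<close>, which is John's condition for the ball.  Concretely,
  let an ellipsoid \<open>A B + b\<close> contain the cut points.  Then \<open>A\<close> is invertible, and averaging
  \<open>|A\<^sup>-\<^sup>1 (c + u / 2 - b)|\<^sup>2 \<le> 1\<close> gives \<open>|A\<^sup>-\<^sup>1 (c - b)|\<^sup>2 + |A\<^sup>-\<^sup>1|\<^sup>2 / 4 \<le> 1\<close> in the Frobenius norm, so that \<open>det A\<^sup>-\<^sup>1\<close>
  is bounded in the manner of Hadamard and AM-GM; equality forces \<open>A\<close> to be scalar and \<open>b = c\<close>.
\<close>

section \<open>Determinants and the Frobenius norm\<close>

lemma det_scaleR: "det (t *\<^sub>R B) = t ^ CARD('m) * det (B :: real ^ 'm ^ 'm)"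
proof -
  have "t *\<^sub>R B = (\<chi> i. t *s B $ i)" by (simp add: vec_eq_iff)
  then show ?thesis by (simp add: det_rows_mul)
qed

lemma norm_add_scaleR_square:
  "(norm (x + t *\<^sub>R y))\<^sup>2 = (norm x)\<^sup>2 + 2 * t * (x \<bullet> y) + t\<^sup>2 * (norm y)\<^sup>2"
  for x y :: "'a::real_inner"
  unfolding power2_norm_eq_inner
  by (simp add: inner_simps inner_commute[of y x] power2_eq_square algebra_simps)

text \<open>Pythagoras for the projection of \<open>x\<close> off \<open>y\<close>: the coefficient
  minimises the quadratic in \<open>t\<close> of the preceding expansion. It yields strict
  shortening as soon as \<open>x\<close> and \<open>y\<close> are not orthogonal.\<close>

lemma norm_subtract_projection_square:
  fixes x y :: "'a::real_inner"
  assumes "y \<noteq> 0"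
  shows "(norm (x + (- (x \<bullet> y) / (norm y)\<^sup>2) *\<^sub>R y))\<^sup>2 = (norm x)\<^sup>2 - (x \<bullet> y)\<^sup>2 / (norm y)\<^sup>2"
proof -
  have "2 * (- a / b) * a + (- a / b)\<^sup>2 * b = - (a\<^sup>2 / b)" if "b \<noteq> 0" for a b :: real
    using that by (simp add: field_simps power2_eq_square)
  from this[of "(norm y)\<^sup>2" "x \<bullet> y"] show ?thesis
    using assms unfolding norm_add_scaleR_square by simp
qed

lemma norm_matrix_square: "(norm X)\<^sup>2 = (\<Sum>i\<in>UNIV. (norm (X $ i))\<^sup>2)" for X :: "real ^ 'm ^ 'k"
  by (simp add: norm_vec_def[of X] L2_set_def sum_nonneg)

lemma norm_mat_one_square: "(norm (mat 1 :: real ^ 'm ^ 'm))\<^sup>2 = real CARD('m)"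
proof -
  have "(norm ((mat 1 :: real ^ 'm ^ 'm) $ i))\<^sup>2 = 1" for i
    by (simp add: mat_def power2_norm_eq_inner inner_vec_def if_distrib cong: if_cong)
  then show ?thesis by (simp add: norm_matrix_square)
qed

text \<open>A maximiser of \<open>|det|\<close> over the Frobenius ball has orthogonal rows: projecting one row off another
  keeps the determinant but shortens the matrix, which can then be scaled up.  For orthogonal rows
  \<open>ln q \<le> q - 1\<close>, applied to the squared lengths, replaces AM-GM and settles the equality case.\<close>

lemma det_le_one_of_norm_le:
  fixes B :: "real ^ 'm ^ 'm"
  assumes "(norm B)\<^sup>2 \<le> real CARD('m)"
  shows "\<bar>det B\<bar> \<le> 1" and "\<bar>det B\<bar> = 1 \<Longrightarrow> B ** transpose B = mat 1"
proof -
  define K where "K = cball (0 :: real ^ 'm ^ 'm) (sqrt (real CARD('m)))"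
  have mem_K: "X \<in> K \<longleftrightarrow> (norm X)\<^sup>2 \<le> real CARD('m)" for X
    unfolding K_def by (simp add: real_le_rsqrt sqrt_ge_absD abs_le_square_iff
        flip: real_sqrt_le_iff[of "(norm X)\<^sup>2"])
  have "continuous_on K (\<lambda>X. \<bar>det X\<bar>)"
    unfolding det_def by (intro continuous_intros)
  moreover have "compact K" "K \<noteq> {}"
    by (auto simp: K_def)
  ultimately obtain M where M: "M \<in> K" "\<And>X. X \<in> K \<Longrightarrow> \<bar>det X\<bar> \<le> \<bar>det M\<bar>"
    using continuous_attains_sup[of K "\<lambda>X. \<bar>det X\<bar>"] by blast
  have one_K: "mat 1 \<in> K" by (simp add: mem_K norm_mat_one_square)
  \<comment> \<open>Stated for every maximiser, since it is applied twice: to \<open>M\<close>, to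
    find that the maximum is 1, and to \<open>B\<close> when \<open>\<bar>det B\<bar> = 1\<close>,
    because \<open>B\<close> is then a maximiser itself.\<close>
  have maximal: "\<bar>det X\<bar> = 1 \<and> X ** transpose X = mat 1"
    if X: "X \<in> K" and max: "\<And>Y. Y \<in> K \<Longrightarrow> \<bar>det Y\<bar> \<le> \<bar>det X\<bar>" for X
  proof -
    have det_ge: "1 \<le> \<bar>det X\<bar>" using max[OF one_K] by simp
    have orth: "X $ i \<bullet> X $ j = 0" if "i \<noteq> j" for i j
    proof (rule ccontr)
      assume ne: "X $ i \<bullet> X $ j \<noteq> 0"
      define t where "t = - (X $ i \<bullet> X $ j) / (norm (X $ j))\<^sup>2"
      define Y where "Y = (\<chi> k. if k = i then row i X + t *s row j X else row k X)"
      have Yk: "Y $ k = (if k = i then X $ i + t *\<^sub>R X $ j else X $ k)" for k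
        by (simp add: Y_def row_def vec_eq_iff)
      have detY: "det Y = det X"
        unfolding Y_def by (rule det_row_operation[OF that])
      have "X $ j \<noteq> 0" using ne by auto
      have "(norm (X $ i + t *\<^sub>R X $ j))\<^sup>2 = (norm (X $ i))\<^sup>2 - (X $ i \<bullet> X $ j)\<^sup>2 / (norm (X $ j))\<^sup>2"
        using \<open>X $ j \<noteq> 0\<close> unfolding t_def by (rule norm_subtract_projection_square)
      also have "\<dots> < (norm (X $ i))\<^sup>2"
        using ne \<open>X $ j \<noteq> 0\<close> by simp
      finally have "norm (X $ i + t *\<^sub>R X $ j) < norm (X $ i)"
        by (rule power_less_imp_less_base) simp
      then have "(norm Y)\<^sup>2 < (norm X)\<^sup>2"
        unfolding norm_matrix_square
        by (intro sum_strict_mono_ex1) (auto simp: Yk intro!: exI[of _ i] power_strict_mono)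
      then have nYX: "norm Y < norm X" by (rule power_less_imp_less_base) simp
      \<comment> \<open>\<open>det_scaleR[of 0 X]\<close> says that the zero matrix has determinant
        0, whereas \<open>det Y = det X\<close> is nonzero.\<close>
      have Y0: "Y \<noteq> 0" using detY det_ge det_scaleR[of 0 X] by (auto simp: power_0_left)
      define s where "s = norm X / norm Y"
      have s: "s > 1" using nYX Y0 by (simp add: s_def)
      have "norm (s *\<^sub>R Y) = norm X" using Y0 by (simp add: s_def)
      then have "s *\<^sub>R Y \<in> K" using X by (simp add: mem_K)
      then have "s ^ CARD('m) * \<bar>det X\<bar> \<le> \<bar>det X\<bar>"
        using max[of "s *\<^sub>R Y"] s by (simp add: abs_mult det_scaleR detY)
      then have "s ^ CARD('m) \<le> 1"
        using det_ge mult_le_cancel_right1[of "s ^ CARD('m)" "\<bar>det X\<bar>"]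
          mult_le_cancel_right[of "s ^ CARD('m)" "\<bar>det X\<bar>" 1] by linarith
      moreover have "1 < s ^ CARD('m)" using s by (intro one_less_power) auto
      ultimately show False by simp
    qed
    define q where "q i = (norm (X $ i))\<^sup>2" for i
    have XX: "(X ** transpose X) $ i $ j = X $ i \<bullet> X $ j" for i j
      by (simp add: matrix_matrix_mult_def transpose_def inner_vec_def)
    have "det (X ** transpose X) = (\<Prod>i\<in>UNIV. q i)"
      by (subst det_diagonal) (auto simp: XX orth q_def power2_norm_eq_inner)
    then have prod_q: "(\<Prod>i\<in>UNIV. q i) = \<bar>det X\<bar>\<^sup>2"
      by (simp add: det_mul power2_eq_square)
    have q0: "q i \<noteq> 0" for i
    proof
      assume "q i = 0"
      then have "(\<Prod>i\<in>UNIV. q i) = 0" by auto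
      then show False using prod_q det_ge by simp
    qed
    then have q: "q i > 0" for i by (simp add: q_def)
    have "0 \<le> ln (\<Prod>i\<in>UNIV. q i)"
      unfolding prod_q by (intro ln_ge_zero one_le_power det_ge)
    also have "\<dots> = (\<Sum>i\<in>UNIV. ln (q i))" using q0 by (simp add: ln_prod)
    finally have ln_ge: "0 \<le> (\<Sum>i\<in>UNIV. ln (q i))" .
    \<comment> \<open>This is the Frobenius bound. Together with \<open>ln_ge\<close> it squeezes
      the nonnegative terms \<open>q i - 1 - ln (q i)\<close> to zero, and \<open>ln\<close> meets
      its tangent only at 1.\<close>
    have "(\<Sum>i\<in>UNIV. q i - 1) \<le> 0"
      using X unfolding mem_K norm_matrix_square by (simp add: sum_subtractf q_def)
    then have "(\<Sum>i\<in>UNIV. q i - 1 - ln (q i)) \<le> 0"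
      using ln_ge by (simp add: sum_subtractf)
    moreover have nn: "0 \<le> q i - 1 - ln (q i)" for i
      using ln_le_minus_one[OF q] by simp
    moreover have "0 \<le> (\<Sum>i\<in>UNIV. q i - 1 - ln (q i))" by (rule sum_nonneg) (rule nn)
    ultimately have "(\<Sum>i\<in>UNIV. q i - 1 - ln (q i)) = 0" by linarith
    then have "\<forall>i\<in>UNIV. q i - 1 - ln (q i) = 0"
      by (subst (asm) sum_nonneg_eq_0_iff) (auto intro: nn simp del: diff_ge_0_iff_ge)
    then have q1: "q i = 1" for i
      using ln_eq_minus_one[OF q] by simp
    have "\<bar>det X\<bar>\<^sup>2 = 1" using prod_q by (simp add: q1)
    then have "\<bar>det X\<bar> = 1" unfolding power2_eq_1_iff by linarith
    moreover have "X ** transpose X = mat 1"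
      using q1 by (auto simp: vec_eq_iff XX mat_def orth q_def power2_norm_eq_inner)
    ultimately show ?thesis by simp
  qed
  have B: "B \<in> K" using assms by (simp add: mem_K)
  have det_M: "\<bar>det M\<bar> = 1" using maximal[OF M] by simp
  show "\<bar>det B\<bar> \<le> 1" using M(2)[OF B] det_M by simp
  show "B ** transpose B = mat 1" if "\<bar>det B\<bar> = 1"
    using maximal[OF B] M(2) det_M that by metis
qed

text \<open>Any nonzero \<open>B *v x - x\<close> would be an eigenvector for the eigenvalue -1,
  which positivity rules out.\<close>

lemma psd_square_eq_one:
  fixes B :: "real ^ 'm ^ 'm"
  assumes "positive_semidefinite B" and "B ** B = mat 1"
  shows "B = mat 1"
proof -
  have "B *v x = x" for x
  proof -
    define y where "y = B *v x - x"
    have "B *v y = - y"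
      by (simp add: y_def matrix_vector_mult_diff_distrib matrix_vector_mul_assoc assms(2))
    then have "0 \<le> - (y \<bullet> y)"
      using assms(1) unfolding positive_semidefinite_def by (metis inner_minus_right)
    then have "y = 0" using inner_gt_zero_iff[of y] by linarith
    then show ?thesis by (simp add: y_def)
  qed
  then show ?thesis by (simp add: matrix_eq)
qed

lemma symmetric_inner_commute:
  fixes A :: "real ^ 'm ^ 'm"
  assumes "transpose A = A"
  shows "x \<bullet> (A *v y) = (A *v x) \<bullet> y"
  using dot_lmul_matrix[of x A y] transpose_matrix_vector[of A x] by (simp add: assms)

lemma positive_semidefinite_scaleR:
  "0 \<le> t \<Longrightarrow> positive_semidefinite A \<Longrightarrow> positive_semidefinite (t *\<^sub>R A)"
  by (simp add: positive_semidefinite_def transpose_scalar flip: scaleR_matrix_vector_assoc)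

section \<open>Ellipsoids\<close>

text \<open>The library states \<open>measure_linear_image\<close> for well-ordered index types only; the order itself is
  immaterial.\<close>

instantiation upair :: (card2) wellorder
begin

definition upair_index :: "'a upair \<Rightarrow> nat" where
  "upair_index = (SOME f. inj f)"

definition less_eq_upair :: "'a upair \<Rightarrow> 'a upair \<Rightarrow> bool" where
  "e \<le> f \<longleftrightarrow> upair_index e \<le> upair_index f"

definition less_upair :: "'a upair \<Rightarrow> 'a upair \<Rightarrow> bool" where
  "e < f \<longleftrightarrow> upair_index e < upair_index f"

instance
proof
  have inj: "inj (upair_index :: 'a upair \<Rightarrow> nat)"
    unfolding upair_index_def
    using finite_imp_inj_to_nat_seg[of "UNIV :: 'a upair set"] by (metis finite someI_ex)
  fix e f g :: "'a upair" and P :: "'a upair \<Rightarrow> bool"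
  show "(e < f) = (e \<le> f \<and> \<not> f \<le> e)"
    by (auto simp: less_eq_upair_def less_upair_def)
  show "e \<le> e" "e \<le> f \<or> f \<le> e"
    by (auto simp: less_eq_upair_def)
  show "e \<le> g" if "e \<le> f" "f \<le> g"
    using that by (simp add: less_eq_upair_def)
  show "e = f" if "e \<le> f" "f \<le> e"
    using that inj by (simp add: less_eq_upair_def inj_eq)
  show "P e" if step: "\<And>e. (\<And>f. f < e \<Longrightarrow> P f) \<Longrightarrow> P e"
  proof (induction e rule: measure_induct_rule[of upair_index])
    case (less e)
    show ?case by (rule step, rule less) (simp add: less_upair_def)
  qed
qed

end

text \<open>Turns the comparison of volumes into a comparison of \<open>\<bar>det A\<bar>\<close>,
  degenerate ellipsoids included.\<close>

lemma measure_ellipsoid: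
  fixes A :: "real ^ 'm::{finite,wellorder} ^ 'm::_"
  shows "measure lebesgue ((\<lambda>x. A *v x + b) ` cball 0 1) =
    \<bar>det A\<bar> * measure lebesgue (cball (0 :: real ^ 'm::_) 1)"
proof -
  have "(\<lambda>x. A *v x + b) ` cball 0 1 = (+) b ` ((*v) A ` cball 0 1)"
    by (auto simp: image_image add.commute)
  then show ?thesis
    using measure_linear_image[of "(*v) A" "cball 0 1"] by (simp add: measure_translation)
qed

lemma ellipsoid_scaled_one:
  fixes b :: "real ^ 'm"
  assumes "0 < t"
  shows "(\<lambda>x. (t *\<^sub>R mat 1) *v x + b) ` cball 0 1 = cball b t"
proof -
  have "(\<lambda>x. (t *\<^sub>R mat 1) *v x + b) ` cball 0 1 = (+) b ` ((*\<^sub>R) t ` cball 0 1)"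
    by (simp add: scaleR_matrix_vector_assoc[symmetric] image_image add.commute)
  also have "\<dots> = (+) b ` cball 0 t"
    using cball_scale[of t "0 :: real ^ 'm" 1] assms by simp
  also have "\<dots> = cball b t"
    using cball_translation[of b 0 t] by simp
  finally show ?thesis .
qed

text \<open>John's condition detached from cuts. Taking the trace in \<open>isotropic\<close>, the
  squared lengths of the \<open>u s\<close> average to \<open>CARD('m)\<close>, so
  \<open>\<rho> * sqrt (real CARD('m))\<close> is the root mean square distance of the points from
  \<open>c\<close>.\<close>

lemma isotropic_points_in_ellipsoid:
  fixes u :: "'s \<Rightarrow> real ^ 'm"
  assumes I: "finite I" "I \<noteq> {}"
    and centered: "(\<Sum>s\<in>I. u s) = 0"
    and isotropic: "\<And>x. (\<Sum>s\<in>I. (u s \<bullet> x)\<^sup>2) = real (card I) * (norm x)\<^sup>2"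
    and \<rho>: "0 < \<rho>"
    and A: "positive_semidefinite A"
    and contained: "\<And>s. s \<in> I \<Longrightarrow> c + \<rho> *\<^sub>R u s \<in> (\<lambda>x. A *v x + b) ` cball 0 1"
  shows "(\<rho> * sqrt (real CARD('m))) ^ CARD('m) \<le> \<bar>det A\<bar>"
    and "\<bar>det A\<bar> = (\<rho> * sqrt (real CARD('m))) ^ CARD('m) \<Longrightarrow>
           A = (\<rho> * sqrt (real CARD('m))) *\<^sub>R mat 1 \<and> b = c"
proof -
  define N where "N = real (card I)"
  define R where "R = \<rho> * sqrt (real CARD('m))"
  have N: "0 < N" using I by (simp add: N_def card_gt_0_iff)
  have R: "0 < R" using \<rho> by (simp add: R_def)
  have tA: "transpose A = A" using A by (simp add: positive_semidefinite_def)
  obtain x where x: "\<And>s. s \<in> I \<Longrightarrow> norm (x s) \<le> 1"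
    "\<And>s. s \<in> I \<Longrightarrow> c + \<rho> *\<^sub>R u s = A *v x s + b"
    using contained unfolding image_iff mem_cball_0 Bex_def by metis
  \<comment> \<open>For a singular \<open>A\<close> all points would lie in one hyperplane
    orthogonal to a kernel vector \<open>w\<close>. Centring then makes every \<open>u s\<close>
    orthogonal to \<open>w\<close>, and isotropy gives \<open>w = 0\<close>.\<close>
  have "w = 0" if w: "A *v w = 0" for w
  proof -
    define k where "k = w \<bullet> (b - c)"
    have k: "\<rho> * (u s \<bullet> w) = k" if "s \<in> I" for s
    proof -
      have "w \<bullet> (c + \<rho> *\<^sub>R u s) = w \<bullet> (A *v x s + b)" by (simp add: x(2)[OF that])
      also have "\<dots> = w \<bullet> b" by (simp add: inner_add_right symmetric_inner_commute[OF tA] w)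
      finally show ?thesis by (simp add: k_def inner_simps inner_commute)
    qed
    have "N * k = (\<Sum>s\<in>I. \<rho> * (u s \<bullet> w))" by (simp add: k N_def)
    also have "\<dots> = \<rho> * ((\<Sum>s\<in>I. u s) \<bullet> w)" by (simp add: inner_sum_left sum_distrib_left)
    finally have "k = 0" using N by (simp add: centered)
    then have "u s \<bullet> w = 0" if "s \<in> I" for s using k[OF that] \<rho> by simp
    then have "N * (norm w)\<^sup>2 = 0" using isotropic[of w] by (simp add: N_def)
    then show ?thesis using N by simp
  qed
  then have "\<exists>B. B ** A = mat 1" by (simp add: matrix_left_invertible_ker)
  then obtain B where BA: "B ** A = mat 1" by blast
  then have AB: "A ** B = mat 1" by (simp add: matrix_left_right_inverse)
  have tB: "transpose B = B"
  proof -
    have "transpose B ** A = mat 1"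
      using AB by (metis tA matrix_transpose_mul transpose_mat)
    then show ?thesis
      by (metis AB matrix_mul_assoc matrix_mul_lid matrix_mul_rid)
  qed
  have B: "positive_semidefinite B"
    unfolding positive_semidefinite_def
  proof (intro conjI allI)
    fix y
    have "y \<bullet> (B *v y) = (A *v (B *v y)) \<bullet> (B *v y)" 
      by (simp add: matrix_vector_mul_assoc AB)
    then show "0 \<le> y \<bullet> (B *v y)"
      using A by (simp add: positive_semidefinite_def inner_commute)
  qed (rule tB)
  define z where "z = B *v (c - b)"
  have xs: "x s = z + \<rho> *\<^sub>R (B *v u s)" if "s \<in> I" for s
  proof -
    have "x s = B *v (A *v x s)" by (simp add: matrix_vector_mul_assoc BA)
    also have "A *v x s = (c - b) + \<rho> *\<^sub>R u s" using x(2)[OF that] by (simp add: algebra_simps)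
    finally show ?thesis
      by (simp add: z_def matrix_vector_right_distrib matrix_vector_mult_scaleR)
  qed
  \<comment> \<open>The entries of \<open>B *v u s\<close> are inner products with the rows of
    \<open>B\<close>, so isotropy is applied to each row as test vector.\<close>
  have sum_Bu: "(\<Sum>s\<in>I. (norm (B *v u s))\<^sup>2) = N * (norm B)\<^sup>2"
  proof -
    have "(\<Sum>s\<in>I. (norm (B *v u s))\<^sup>2) = (\<Sum>s\<in>I. \<Sum>i\<in>UNIV. (u s \<bullet> B $ i)\<^sup>2)"
      by (simp add: norm_vec_def[of "B *v _"] L2_set_def sum_nonneg matrix_vector_mul_component inner_commute)
    also have "\<dots> = (\<Sum>i\<in>UNIV. N * (norm (B $ i))\<^sup>2)"
      by (subst sum.swap) (simp add: isotropic N_def)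
    also have "\<dots> = N * (norm B)\<^sup>2"
      by (simp add: norm_matrix_square[of B] sum_distrib_left)
    finally show ?thesis .
  qed
  have "(\<Sum>s\<in>I. (norm (x s))\<^sup>2) =
      (\<Sum>s\<in>I. (norm z)\<^sup>2 + 2 * \<rho> * (z \<bullet> (B *v u s)) + \<rho>\<^sup>2 * (norm (B *v u s))\<^sup>2)"
    by (simp add: xs norm_add_scaleR_square)
  \<comment> \<open>The cross terms collect into the sum of the \<open>u s\<close>, which is
    zero.\<close>
  also have "\<dots> = N * (norm z)\<^sup>2 + 2 * \<rho> * (z \<bullet> (B *v (\<Sum>s\<in>I. u s))) + \<rho>\<^sup>2 * (N * (norm B)\<^sup>2)"
    by (simp add: sum.distrib N_def[symmetric] sum_Bu sum_distrib_left[symmetric]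
        inner_sum_right[symmetric] linear_sum[OF matrix_vector_mul_linear])
  finally have "(\<Sum>s\<in>I. (norm (x s))\<^sup>2) = N * ((norm z)\<^sup>2 + \<rho>\<^sup>2 * (norm B)\<^sup>2)"
    by (simp add: centered algebra_simps)
  moreover have "(\<Sum>s\<in>I. (norm (x s))\<^sup>2) \<le> N * 1"
    using sum_bounded_above[of I "\<lambda>s. (norm (x s))\<^sup>2" 1] x(1) by (simp add: N_def power_le_one)
  ultimately have le_1: "(norm z)\<^sup>2 + \<rho>\<^sup>2 * (norm B)\<^sup>2 \<le> 1"
    using N by simp
  \<comment> \<open>The scaling turns \<open>le_1\<close> into the Frobenius bound under which
    \<open>\<bar>det C\<bar> \<le> 1\<close>.\<close>
  define C where "C = R *\<^sub>R B"
  have norm_C: "(norm C)\<^sup>2 = real CARD('m) * (\<rho>\<^sup>2 * (norm B)\<^sup>2)"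
    by (simp add: C_def R_def power_mult_distrib)
  also have "\<dots> \<le> real CARD('m) * 1"
    using le_1 by (intro mult_left_mono) (auto intro: order_trans[rotated])
  finally have C: "(norm C)\<^sup>2 \<le> real CARD('m)" by simp
  have "det A * det B = 1" using AB by (metis det_mul det_I)
  then have "\<bar>det A\<bar> * \<bar>det B\<bar> = 1" by (simp flip: abs_mult)
  moreover have "\<bar>det C\<bar> = R ^ CARD('m) * \<bar>det B\<bar>"
    using R by (simp add: C_def det_scaleR abs_mult)
  ultimately have detC: "\<bar>det A\<bar> * \<bar>det C\<bar> = R ^ CARD('m)"
    by (simp add: mult.left_commute)
  show "(\<rho> * sqrt (real CARD('m))) ^ CARD('m) \<le> \<bar>det A\<bar>"
    using mult_left_mono[OF det_le_one_of_norm_le(1)[OF C], of "\<bar>det A\<bar>"] detC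
    by (simp add: R_def)
  show "A = (\<rho> * sqrt (real CARD('m))) *\<^sub>R mat 1 \<and> b = c"
    if "\<bar>det A\<bar> = (\<rho> * sqrt (real CARD('m))) ^ CARD('m)"
  proof -
    have "\<bar>det C\<bar> = 1" using detC that R by (simp add: R_def[symmetric])
    then have "C ** transpose C = mat 1" by (rule det_le_one_of_norm_le(2)[OF C])
    moreover have psd: "positive_semidefinite C"
      unfolding C_def using R B by (simp add: positive_semidefinite_scaleR)
    moreover have "transpose C = C"
      using psd by (simp add: positive_semidefinite_def)
    ultimately have C1: "C = mat 1"
      by (simp add: psd_square_eq_one)
    have A_eq: "A = R *\<^sub>R mat 1"
    proof -
      have "A = A ** C" by (simp add: C1)
      also have "\<dots> = R *\<^sub>R (A ** B)" by (simp add: C_def matrix_scalar_ac scalar_matrix_assoc)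
      finally show ?thesis by (simp add: AB)
    qed
    \<comment> \<open>The identity exhausts the Frobenius bound, so \<open>le_1\<close> leaves no
      room for the offset \<open>z\<close> of the centres.\<close>
    have "(norm C)\<^sup>2 = real CARD('m)" by (simp add: C1 norm_mat_one_square)
    then have "\<rho>\<^sup>2 * (norm B)\<^sup>2 = 1" using norm_C by simp
    then have "z = 0" using le_1 by simp
    then have "A *v (B *v (c - b)) = 0" by (simp add: z_def)
    then have "b = c" by (simp add: matrix_vector_mul_assoc AB)
    then show ?thesis using A_eq by (simp add: R_def)
  qed
qed

section \<open>Cuts and the metric polytope\<close>

text \<open>The character \<open>\<Prod>i\<in>T. \<epsilon> i\<close> of the sign vector
  \<open>\<epsilon>\<close> that is 1 on \<open>S\<close> and -1 elsewhere.\<close>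

definition cut_sign :: "'n set \<Rightarrow> 'n set \<Rightarrow> real" where
  "cut_sign S T = (\<Prod>i\<in>T. if i \<in> S then 1 else - 1)"

text \<open>The minus sign gives 1 to the pairs separated by \<open>S\<close>, so that half of this
  vector added to the centre is the cut semimetric. A set and its complement give the same vector,
  hence averages over all \<open>S\<close> count each cut twice.\<close>

definition cut_vector :: "'n::card2 set \<Rightarrow> real ^ 'n upair" where
  "cut_vector S = (\<chi> e. - cut_sign S (Rep_upair e))"

lemma card_Rep_upair: "card (Rep_upair e) = 2"
  using Rep_upair[of e] by simp

lemma obtain_upair:
  obtains i j where "i \<noteq> j" "e = upair i j"
  using card_Rep_upair[of e] by (metis Rep_upair_inverse card_2_iff upair_def)

lemma cut_vector_upair:
  "i \<noteq> j \<Longrightarrow> cut_vector S $ upair i j = (if i \<in> S \<longleftrightarrow> j \<in> S then - 1 else 1)"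
  by (simp add: cut_vector_def cut_sign_def Rep_upair_upair)

lemma cut_sign_square: "finite T \<Longrightarrow> cut_sign S T * cut_sign S T = 1"
  unfolding cut_sign_def by (induction T rule: finite_induct) auto

text \<open>Toggling the membership of \<open>i\<close> permutes the subsets, so the sum equals its
  own negative.\<close>

lemma sum_sign_reversing:
  fixes f :: "'n::finite set \<Rightarrow> real"
  assumes "\<And>S. f (sym_diff S {i}) = - f S"
  shows "(\<Sum>S\<in>UNIV. f S) = 0"
proof -
  have "bij (\<lambda>S. sym_diff S {i})"
    by (rule involuntory_imp_bij) auto
  then have "(\<Sum>S\<in>UNIV. f S) = (\<Sum>S\<in>UNIV. f (sym_diff S {i}))"
    by (rule sum.reindex_bij_betw[symmetric])
  also have "\<dots> = - (\<Sum>S\<in>UNIV. f S)" by (simp add: assms sum_negf)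
  finally show ?thesis by simp
qed

lemma cut_sign_toggle:
  assumes "finite T"
  shows "cut_sign (sym_diff S {i}) T = (if i \<in> T then - cut_sign S T else cut_sign S T)"
proof -
  have *: "(\<Prod>k\<in>T - {i}. if k \<in> sym_diff S {i} then 1 else - 1 :: real) = (\<Prod>k\<in>T - {i}. if k \<in> S then 1 else - 1)"
    by (intro prod.cong) auto
  show ?thesis
  proof (cases "i \<in> T")
    case True
    then show ?thesis
      unfolding cut_sign_def prod.remove[OF assms True] * by auto
  next
    case False
    then show ?thesis using * by (simp add: cut_sign_def)
  qed
qed

lemma sum_cut_vector: "(\<Sum>S\<in>UNIV. cut_vector (S :: 'n::card2 set)) = 0"
proof -
  have "(\<Sum>S\<in>UNIV. cut_sign S (Rep_upair e)) = 0" for e :: "'n upair"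
  proof -
    obtain i where "i \<in> Rep_upair e" using card_Rep_upair[of e] by fastforce
    then show ?thesis by (intro sum_sign_reversing[of _ i]) (simp add: cut_sign_toggle)
  qed
  then show ?thesis by (simp add: vec_eq_iff cut_vector_def sum_negf)
qed

text \<open>Orthogonality of characters: distinct pairs have equal size, so some \<open>i\<close>
  lies in \<open>e\<close> but not in \<open>f\<close>, and toggling it flips exactly one of the two
  factors.\<close>

lemma cut_vector_orthogonal:
  fixes e f :: "'n::card2 upair"
  shows "(\<Sum>S\<in>UNIV. cut_vector S $ e * cut_vector S $ f) = (if e = f then real (card (UNIV :: 'n set set)) else 0)"
proof (cases "e = f")
  case True
  then show ?thesis by (simp add: cut_vector_def cut_sign_square)
next
  case False
  then have "Rep_upair e \<noteq> Rep_upair f" by (simp add: Rep_upair_inject)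
  moreover have "card (Rep_upair e) = card (Rep_upair f)" by (simp add: card_Rep_upair)
  ultimately obtain i where i: "i \<in> Rep_upair e" "i \<notin> Rep_upair f"
    by (metis card_subset_eq finite subsetI)
  have "(\<Sum>S\<in>UNIV. cut_vector S $ e * cut_vector S $ f) = 0"
    by (intro sum_sign_reversing[of _ i]) (simp add: cut_vector_def cut_sign_toggle i)
  then show ?thesis using False by simp
qed

lemma cut_vector_isotropic:
  fixes x :: "real ^ 'n::card2 upair"
  shows "(\<Sum>S\<in>UNIV. (cut_vector S \<bullet> x)\<^sup>2) = real (card (UNIV :: 'n set set)) * (norm x)\<^sup>2"
proof -
  have "(\<Sum>S\<in>UNIV. (cut_vector S \<bullet> x)\<^sup>2) =
      (\<Sum>S\<in>UNIV. \<Sum>e\<in>UNIV. \<Sum>f\<in>UNIV. x $ e * x $ f * (cut_vector S $ e * cut_vector S $ f))"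
    by (simp add: inner_vec_def power2_eq_square sum_product mult_ac)
  also have "\<dots> = (\<Sum>e\<in>UNIV. \<Sum>f\<in>UNIV. \<Sum>S\<in>UNIV. x $ e * x $ f * (cut_vector S $ e * cut_vector S $ f))"
    by (subst sum.swap, rule sum.cong[OF refl], rule sum.swap)
  also have "\<dots> = (\<Sum>e\<in>UNIV. x $ e * x $ e * real (card (UNIV :: 'n set set)))"
    by (simp add: sum_distrib_left[symmetric] cut_vector_orthogonal if_distrib cong: if_cong)
  finally show ?thesis
    by (simp add: power2_norm_eq_inner inner_vec_def sum_distrib_left mult_ac)
qed

text \<open>Lying on the same side of a cut is transitive, so \<open>i\<close> and \<open>k\<close>
  cannot be separated unless \<open>j\<close> is separated from one of them.\<close>

lemma cut_in_metric_polytope: "(\<chi> e. 1/2) + (1/2) *\<^sub>R cut_vector S \<in> metric_polytope"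
proof -
  have "((\<chi> e. 1/2) + (1/2) *\<^sub>R cut_vector S) $ e \<in> {0..1}" for e
    by (rule obtain_upair[of e]) (simp add: cut_vector_upair)
  then show ?thesis
    by (auto simp: metric_polytope_def cut_vector_upair)
qed

text \<open>The ball circumscribes the unit cube: every coordinate is within 1/2 of the
  centre.\<close>

lemma metric_polytope_subset_cball:
  "(metric_polytope :: (real ^ 'n::card2 upair) set) \<subseteq> cball (\<chi> e. 1/2) (1/2 * sqrt (real CARD('n upair)))"
proof
  fix d :: "real ^ 'n upair" assume "d \<in> metric_polytope"
  then have d: "0 \<le> d $ e" "d $ e \<le> 1" for e by (auto simp: metric_polytope_def)
  have "(norm (d - (\<chi> e. 1/2)))\<^sup>2 = (\<Sum>e\<in>UNIV. (d $ e - 1/2)\<^sup>2)"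
    by (simp add: norm_vec_def L2_set_def sum_nonneg)
  also have "\<dots> \<le> (\<Sum>e\<in>(UNIV :: 'n upair set). (1/2)\<^sup>2)"
  proof (intro sum_mono)
    fix e show "(d $ e - 1/2)\<^sup>2 \<le> (1/2)\<^sup>2"
      using d[of e] by (intro abs_le_square_iff[THEN iffD1]) (simp add: abs_if)
  qed
  also have "\<dots> = (1/2 * sqrt (real CARD('n upair)))\<^sup>2"
    by (simp add: power_mult_distrib power_divide)
  finally have "norm (d - (\<chi> e. 1/2)) \<le> 1/2 * sqrt (real CARD('n upair))"
    by (rule power2_le_imp_le) simp
  then show "d \<in> cball (\<chi> e. 1/2) (1/2 * sqrt (real CARD('n upair)))"
    by (simp add: dist_norm norm_minus_commute)
qed

lemma upair_eq_iff:
  assumes "i \<noteq> j" "k \<noteq> l"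
  shows "upair i j = upair k l \<longleftrightarrow> i = k \<and> j = l \<or> i = l \<and> j = k"
proof -
  have "upair i j = upair k l \<longleftrightarrow> {i, j} = {k, l}"
    using Rep_upair_inject[of "upair i j" "upair k l"] assms by (simp add: Rep_upair_upair)
  then show ?thesis by (simp only: doubleton_eq_iff)
qed

text \<open>The inradius is the distance \<open>1 / (2 * sqrt 3)\<close> from the centre to the hyperplanes
  \<open>d\<^sub>i\<^sub>j + d\<^sub>j\<^sub>k - d\<^sub>i\<^sub>k = 0\<close>, whose normals \<open>p\<close> below have length \<open>sqrt 3\<close>.\<close>

lemma cball_subset_metric_polytope_iff:
  fixes t :: real
  assumes "3 \<le> CARD('n::card2)" and "0 \<le> t"
  shows "cball (\<chi> e. 1/2) t \<subseteq> (metric_polytope :: (real ^ 'n upair) set) \<longleftrightarrow> t \<le> 1 / (2 * sqrt 3)"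
proof -
  define p :: "'n \<Rightarrow> 'n \<Rightarrow> 'n \<Rightarrow> real ^ 'n upair" where
    "p i j k = axis (upair i j) 1 + axis (upair j k) 1 - axis (upair i k) 1" for i j k
  have p_inner: "p i j k \<bullet> d = d $ upair i j + d $ upair j k - d $ upair i k" for i j k d
    by (simp add: p_def inner_simps inner_axis')
  have norm_p: "norm (p i j k) = sqrt 3" if "distinct [i, j, k]" for i j k
  proof -
    \<comment> \<open>The three pairs of a triangle are distinct coordinates, carrying the entries
      1, 1 and -1.\<close>
    have "p i j k \<bullet> p i j k = 3"
      unfolding p_inner using that by (auto simp: p_def axis_def upair_eq_iff)
    then show ?thesis by (simp add: norm_eq_sqrt_inner)
  qed
  define c :: "real ^ 'n upair" where "c = (\<chi> e. 1/2)"
  have p_c: "p i j k \<bullet> c = 1/2" for i j k by (simp add: p_inner c_def)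
  have "cball c t \<subseteq> metric_polytope" if t: "t \<le> 1 / (2 * sqrt 3)"
  proof
    fix d assume "d \<in> cball c t"
    then have dn: "norm (d - c) \<le> 1 / (2 * sqrt 3)"
      using t by (simp add: dist_norm norm_minus_commute)
    \<comment> \<open>The faces of the cube are at distance 1/2 from the centre, farther than the
      triangle hyperplanes.\<close>
    moreover have "1 / (2 * sqrt 3) \<le> (1/2 :: real)" by (simp add: field_simps)
    ultimately have "\<bar>(d - c) $ e\<bar> \<le> 1/2" for e
      using component_le_norm_cart[of "d - c" e] by linarith
    then have "d $ e \<in> {0..1}" for e
      by (simp add: c_def abs_le_iff) (smt (verit) field_sum_of_halves)
    moreover have "0 \<le> d $ upair i j + d $ upair j k - d $ upair i k" if ijk: "distinct [i, j, k]" for i j k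
    proof -
      have "\<bar>p i j k \<bullet> (d - c)\<bar> \<le> sqrt 3 * norm (d - c)"
        using Cauchy_Schwarz_ineq2[of "p i j k" "d - c"] norm_p[OF ijk] by simp
      also have "\<dots> \<le> sqrt 3 * (1 / (2 * sqrt 3))" by (intro mult_left_mono dn) auto
      finally have "\<bar>p i j k \<bullet> d - 1/2\<bar> \<le> 1/2" by (simp add: inner_diff_right p_c)
      then show ?thesis unfolding p_inner by linarith
    qed
    ultimately show "d \<in> metric_polytope" by (simp add: metric_polytope_def)
  qed
  moreover have "t \<le> 1 / (2 * sqrt 3)" if sub: "cball c t \<subseteq> metric_polytope"
  proof -
    obtain T :: "'n set" where "card T = 3"
      using obtain_subset_with_card_n[OF assms(1)] by blast
    then obtain i j k :: 'n where ijk: "distinct [i, j, k]" by (auto simp: card_3_iff)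
    \<comment> \<open>The point of the ball farthest in direction \<open>- p i j k\<close>, hence
      the first to violate the triangle inequality.\<close>
    define d where "d = c - (t / sqrt 3) *\<^sub>R p i j k"
    have "d \<in> cball c t" using assms(2) by (simp add: d_def dist_norm norm_p[OF ijk])
    then have "d \<in> metric_polytope" using sub by blast
    then have "0 \<le> p i j k \<bullet> d" using ijk by (auto simp: metric_polytope_def p_inner)
    also have "p i j k \<bullet> d = 1/2 - t / sqrt 3 * 3"
      by (simp add: d_def inner_diff_right p_c dot_square_norm norm_p[OF ijk])
    finally have "t * (3 / sqrt 3) \<le> 1/2" by simp
    then have "t * sqrt 3 \<le> 1/2" by (simp only: real_div_sqrt)
    then show ?thesis by (simp add: field_simps)
  qed
  ultimately show ?thesis by (auto simp: c_def)
qed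

section \<open>Shrunken balls and the assembly of both claims\<close>

lemma shrink_cball:
  assumes "0 < s"
  shows "shrink c s (cball c r) = cball (c :: 'a::real_normed_vector) (r / s)"
proof -
  have "shrink c s (cball c r) = (+) c ` ((*\<^sub>R) (1 / s) ` ((+) (- c) ` cball c r))"
    by (simp add: shrink_def image_image)
  also have "\<dots> = (+) c ` ((*\<^sub>R) (1 / s) ` cball 0 r)"
    using cball_translation[of "- c" c r] by simp
  also have "\<dots> = (+) c ` cball 0 (r / s)"
    using cball_scale[of "1 / s" "0 :: 'a" r] assms by simp
  also have "\<dots> = cball c (r / s)"
    using cball_translation[of c 0] by simp
  finally show ?thesis .
qed

theorem theorem1p2:
  fixes n :: nat
    and c :: "real ^ 'n::card2 upair"
    and r \<sigma> :: real
    and \<E> :: "(real ^ 'n upair) set"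
  assumes "n = CARD('n)" and "n \<ge> 3"
    and "c = (\<chi> e. 1/2)"
    and "r = 1/2 * sqrt (real (n choose 2))"
    and "\<sigma> = sqrt (3 * real (n choose 2))"
    and "\<E> = cball c r"
  shows "(\<forall>E. least_volume_ellipsoid (metric_polytope :: (real ^ 'n upair) set) E \<longleftrightarrow> E = \<E>) \<and>
         shrink c \<sigma> \<E> = cball c (r / \<sigma>) \<and>
         shrink c \<sigma> \<E> \<subseteq> metric_polytope \<and>
         (\<forall>s. 0 < s \<and> s < \<sigma> \<longrightarrow> \<not> shrink c s \<E> \<subseteq> metric_polytope)"
proof -
  define m where "m = real CARD('n upair)"
  define K :: "(real ^ 'n upair) set" where "K = metric_polytope"
  have m: "real (n choose 2) = m"
    using assms(1) by (simp add: m_def CARD_upair)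
  have m_pos: "0 < m" by (simp add: m_def)
  have r: "r = 1/2 * sqrt m" and \<sigma>: "\<sigma> = sqrt 3 * sqrt m"
    unfolding assms(4,5) m by (simp_all add: real_sqrt_mult)
  have r_pos: "0 < r" and \<sigma>_pos: "0 < \<sigma>"
    unfolding r \<sigma> using m_pos by simp_all
  \<comment> \<open>The factor \<open>sqrt m\<close> cancels, leaving exactly the inradius.\<close>
  have r_\<sigma>: "r / \<sigma> = 1 / (2 * sqrt 3)"
    using m_pos by (simp add: r \<sigma>)
  let ?v = "measure lebesgue (cball (0 :: real ^ 'n upair) 1)"
  have v_pos: "0 < ?v" by (simp add: content_cball_pos)
  have K_sub: "K \<subseteq> \<E>"
    using metric_polytope_subset_cball by (simp add: K_def assms(3,6) r m_def)
  have ball_eq: "\<E> = (\<lambda>x. (r *\<^sub>R mat 1) *v x + c) ` cball 0 1"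
    using ellipsoid_scaled_one[OF r_pos, of c] by (simp add: assms(6))
  have ball_ell: "ellipsoid \<E>"
    unfolding ellipsoid_def ball_eq
    using positive_semidefinite_scaleR[of r "mat 1"] r_pos
    by (intro exI[of _ "r *\<^sub>R mat 1"] exI[of _ c])
       (simp add: positive_semidefinite_def)
  have vol_ball: "measure lebesgue \<E> = r ^ CARD('n upair) * ?v"
    unfolding ball_eq measure_ellipsoid using r_pos by (simp add: det_scaleR)
  \<comment> \<open>The cut points satisfy John's condition with \<open>\<rho> = 1/2\<close>. The
    bound gives minimality of the ball, its equality case uniqueness.\<close>
  have lower: "r ^ CARD('n upair) \<le> \<bar>det A\<bar> \<and>
      (\<bar>det A\<bar> = r ^ CARD('n upair) \<longrightarrow> A = r *\<^sub>R mat 1 \<and> b = c)"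
    if "positive_semidefinite A" "K \<subseteq> (\<lambda>x. A *v x + b) ` cball 0 1" for A b
  proof -
    have cuts: "c + (1/2) *\<^sub>R cut_vector S \<in> (\<lambda>x. A *v x + b) ` cball 0 1" for S
      using cut_in_metric_polytope[of S] that(2) by (auto simp: assms(3) K_def)
    note isotropic_points_in_ellipsoid[OF finite UNIV_not_empty sum_cut_vector
        cut_vector_isotropic _ that(1) cuts]
    then show ?thesis unfolding r m_def by simp
  qed
  have least_iff: "least_volume_ellipsoid K E \<longleftrightarrow> E = \<E>" for E
  proof
    assume least: "least_volume_ellipsoid K E"
    then obtain A b where A: "positive_semidefinite A" and E: "E = (\<lambda>x. A *v x + b) ` cball 0 1"
      by (auto simp: least_volume_ellipsoid_def ellipsoid_def)
    have "measure lebesgue E \<le> measure lebesgue \<E>"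
      using least ball_ell K_sub by (simp add: least_volume_ellipsoid_def)
    then have "\<bar>det A\<bar> \<le> r ^ CARD('n upair)"
      unfolding E measure_ellipsoid vol_ball using v_pos by simp
    moreover have "K \<subseteq> (\<lambda>x. A *v x + b) ` cball 0 1"
      using least E by (simp add: least_volume_ellipsoid_def)
    ultimately show "E = \<E>"
      using lower[OF A, of b] by (simp add: E ball_eq)
  next
    assume "E = \<E>"
    moreover have "measure lebesgue \<E> \<le> measure lebesgue F" if F: "ellipsoid F" "K \<subseteq> F" for F
    proof -
      obtain A b where A: "positive_semidefinite A" and Fe: "F = (\<lambda>x. A *v x + b) ` cball 0 1"
        using F(1) by (auto simp: ellipsoid_def)
      have "r ^ CARD('n upair) \<le> \<bar>det A\<bar>" using lower[OF A, of b] F(2) Fe by simp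
      then show ?thesis
        unfolding Fe measure_ellipsoid vol_ball by (simp add: mult_right_mono)
    qed
    ultimately show "least_volume_ellipsoid K E"
      using ball_ell K_sub by (simp add: least_volume_ellipsoid_def)
  qed
  have inner_iff: "cball c t \<subseteq> K \<longleftrightarrow> t \<le> r / \<sigma>" if "0 \<le> t" for t
    using cball_subset_metric_polytope_iff[where 'n='n, OF _ that] assms(1,2)
    by (simp add: K_def assms(3) r_\<sigma>)
  have shrink: "shrink c s \<E> = cball c (r / s)" if "0 < s" for s
    using that by (simp add: assms(6) shrink_cball)
  have "\<not> shrink c s \<E> \<subseteq> K" if "0 < s" "s < \<sigma>" for s
  proof -
    \<comment> \<open>Shrinking by less leaves a radius above the inradius.\<close>
    have "r / \<sigma> < r / s" using that r_pos by (simp add: frac_less2)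
    then show ?thesis using that r_pos by (simp add: shrink inner_iff)
  qed
  moreover have "shrink c \<sigma> \<E> \<subseteq> K"
    using \<sigma>_pos r_pos by (simp add: shrink inner_iff)
  ultimately show ?thesis
    using least_iff shrink[OF \<sigma>_pos] unfolding K_def by blast
qed

end
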